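(* Let $\mathbb P_0$ be a distribution of $(x,y)\in\mathbb R^d\times\{\pm1\}$, let $\sigma>0$, $B>0$, $\lambda>0$, and assume: (i) $\mathbb E_{\mathbb P_0}[xx^\top]\preceq\sigma^2 I_d$; (ii) for all unit vectors $v\in\mathbb R^d$, $\Pr_{(x,y)\sim\mathbb P_0}[|v\cdot x|\le\lambda\sigma]\le B\lambda$. For $w\in\mathbb R^d$ let $w_P$ be the projection of $w$ onto the closed Euclidean ball of radius $1/(\lambda\sigma)$ centered at the origin, i.e. $w_P=\min\{1,1/(\lambda\sigma\|w\|_2)\}\,w$ (and $w_P=0$ if $w=0$). Then $$\mathbb E_{(x,y)\sim\mathbb P_0}\big[(1-y\,(w_P\cdot x))_+\big]\le\mathbb E_{(x,y)\sim\mathbb P_0}\big[(1-y\,(w\cdot x))_+\big]+2B\lambda.$$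
   Context: $(t)_+=\max\{t,0\}$, so $(1-y\,w\cdot x)_+$ is the hinge loss. $A\preceq B$ denotes the positive semidefinite order. *)

theory Defs
  imports "HOL-Probability.Probability"
begin

definition psd_matrix :: "real ^ 'n ^ 'n \<Rightarrow> bool" where
  "psd_matrix A \<longleftrightarrow> transpose A = A \<and> (\<forall>v. 0 \<le> v \<bullet> (A *v v))"

definition loewner_le :: "real ^ 'n ^ 'n \<Rightarrow> real ^ 'n ^ 'n \<Rightarrow> bool"  (infix "\<preceq>\<^sub>L" 50) where
  "A \<preceq>\<^sub>L B \<longleftrightarrow> psd_matrix (B - A)"

text \<open>Labels are reals that equal \<open>1\<close> or \<open>-1\<close> almost surely, so that they can be
  multiplied with margins without a coercion.\<close>

definition labelled_distribution :: "((real ^ 'd) \<times> real) measure \<Rightarrow> bool" where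
  "labelled_distribution P \<longleftrightarrow>
     prob_space P \<and> sets P = sets borel \<and> (AE (x, y) in P. y \<in> {- 1, 1})"

text \<open>The Bochner integral of a non-integrable function is \<open>0\<close> by convention, so existence of
  the entries of \<^term>\<open>second_moment P\<close> has to be required separately.\<close>

definition has_second_moment :: "((real ^ 'd) \<times> real) measure \<Rightarrow> bool" where
  "has_second_moment P \<longleftrightarrow> (\<forall>i j. integrable P (\<lambda>(x, y). x $ i * x $ j))"

definition second_moment :: "((real ^ 'd) \<times> real) measure \<Rightarrow> real ^ 'd ^ 'd" where
  "second_moment P = (\<chi> i j. \<integral>(x, y). x $ i * x $ j \<partial>P)"

definition expected_hinge :: "((real ^ 'd) \<times> real) measure \<Rightarrow> real ^ 'd \<Rightarrow> real" where
  "expected_hinge P w = (\<integral>(x, y). max (1 - y * (w \<bullet> x)) 0 \<partial>P)"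

definition ball_projection :: "real \<Rightarrow> 'a::euclidean_space \<Rightarrow> 'a" where
  "ball_projection r w = closest_point (cball 0 r) w"

lemma ball_projection_eq:
  fixes w :: "'a::euclidean_space"
  assumes "r > 0"
  shows "ball_projection r w = (if w = 0 then 0 else min 1 (r / norm w) *\<^sub>R w)"
proof (cases "norm w \<le> r")
  case True
  then have "w \<in> cball 0 r" by simp
  then have "ball_projection r w = w"
    by (simp add: ball_projection_def closest_point_self)
  moreover have "min 1 (r / norm w) = 1" if "w \<noteq> 0"
    using True that by (simp add: field_simps)
  ultimately show ?thesis by simp
next
  case False
  then have w: "norm w > r" "w \<noteq> 0" using assms by auto
  let ?p = "(r / norm w) *\<^sub>R w"
  have p: "?p \<in> cball 0 r" using assms w by simp
  have "dist w ?p \<le> dist w z" if "z \<in> cball 0 r" for z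
  proof -
    have "w - ?p = (1 - r / norm w) *\<^sub>R w" by (simp add: algebra_simps)
    then have "dist w ?p = \<bar>1 - r / norm w\<bar> * norm w" by (simp add: dist_norm)
    also have "\<dots> = norm w - r" using assms w by (simp add: field_simps)
    also have "\<dots> \<le> norm w - norm z" using that by simp
    also have "\<dots> \<le> dist w z" unfolding dist_norm by (rule norm_triangle_ineq2)
    finally show ?thesis .
  qed
  then have "?p = ball_projection r w"
    unfolding ball_projection_def using p by (intro closest_point_unique) auto
  moreover have "min 1 (r / norm w) = r / norm w" using w assms by (simp add: field_simps)
  ultimately show ?thesis using w by simp
qed

end

theory Submission
  imports Defs
begin

text \<open>If \<open>\<parallel>w\<parallel>\<close> exceeds the radius \<open>1 / (\<lambda>\<sigma>)\<close>, then \<open>w = s w\<^sub>P\<close> with \<open>s \<ge> 1\<close>. Off the band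
  \<open>\<bar>w\<^sub>P \<bullet> x\<bar> \<le> 1\<close>, scaling the margin up can only increase the hinge loss: it is \<open>0\<close> at a margin
  above \<open>1\<close>, and it decreases in the margin. On the band the loss of \<open>w\<^sub>P\<close> is at most \<open>2\<close>, and for
  the unit vector \<open>v = w / \<parallel>w\<parallel>\<close> the band is the event \<open>\<bar>v \<bullet> x\<bar> \<le> \<lambda>\<sigma>\<close>.\<close>

lemma hinge_le_hinge_scaled:
  fixes m s :: real
  assumes "1 \<le> s"
  shows "max (1 - m) 0 \<le> max (1 - s * m) 0 + 2 * of_bool (\<bar>m\<bar> \<le> 1)"
\<comment> \<open>For \<open>m \<ge> - 1\<close> the left side is at most 2 on the band and 0 beyond
  it, so the two hinge terms have to be compared only for \<open>m < - 1\<close>.\<close>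
proof (cases "m < - 1")
  case True
  then have "s * m \<le> 1 * m" using assms by (intro mult_right_mono_neg) auto
  then show ?thesis by auto
qed auto

text \<open>On a probability space square-integrable coordinates are integrable, hence so is
  \<open>w \<bullet> x\<close>. Labels of modulus 1 then bound the loss by
  \<open>1 + \<bar>w \<bullet> x\<bar>\<close>. Comparing expected losses by monotonicity of the
  integral rests on this.\<close>

lemma integrable_hinge:
  fixes P :: "((real ^ 'd) \<times> real) measure"
  assumes "labelled_distribution P" "has_second_moment P"
  shows "integrable P (\<lambda>(x, y). max (1 - y * (w \<bullet> x)) 0)"
proof -
  from assms(1) interpret prob_space P by (simp add: labelled_distribution_def)
  have sets: "sets P = sets borel" and ae: "AE z in P. snd z \<in> {- 1, 1}"
    using assms(1) by (auto simp: labelled_distribution_def case_prod_unfold)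
  have borel: "f \<in> borel_measurable P" if "continuous_on UNIV f" for f :: "_ \<Rightarrow> real"
    using borel_measurable_continuous_onI[OF that] measurable_cong_sets[OF sets refl] by blast
  have sq: "integrable P (\<lambda>z. (fst z $ i)\<^sup>2)" for i
    using assms(2) by (auto simp: has_second_moment_def case_prod_unfold power2_eq_square)
  have "integrable P (\<lambda>z. fst z $ i)" for i
  proof (rule square_integrable_imp_integrable[OF _ sq])
    show "(\<lambda>z. fst z $ i) \<in> borel_measurable P" by (intro borel continuous_intros)
  qed
  then have "integrable P (\<lambda>z. w \<bullet> fst z)"
    by (auto simp: inner_vec_def)
  then have "integrable P (\<lambda>z. 1 + \<bar>w \<bullet> fst z\<bar>)" by auto
  then have "integrable P (\<lambda>z. max (1 - snd z * (w \<bullet> fst z)) 0)"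
  proof (rule Bochner_Integration.integrable_bound)
    show "(\<lambda>z. max (1 - snd z * (w \<bullet> fst z)) 0) \<in> borel_measurable P"
      by (intro borel continuous_intros)
    show "AE z in P. norm (max (1 - snd z * (w \<bullet> fst z)) 0) \<le> norm (1 + \<bar>w \<bullet> fst z\<bar>)"
      using ae by eventually_elim auto
  qed
  then show ?thesis by (simp add: case_prod_unfold)
qed

text \<open>The pointwise bound is integrated at the margin \<open>m = y * (u \<bullet> x)\<close>.
  Starting from the shorter vector \<open>u\<close> and a factor \<open>s\<close> keeps norms and
  projections out of the integration.\<close>

lemma expected_hinge_le_scaled:
  fixes P :: "((real ^ 'd) \<times> real) measure" and u :: "real ^ 'd"
  assumes P: "labelled_distribution P" "has_second_moment P" and "1 \<le> s"
  shows "expected_hinge P u \<le> expected_hinge P (s *\<^sub>R u)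
           + 2 * measure P {(x, y) \<in> space P. \<bar>u \<bullet> x\<bar> \<le> 1}"
proof -
  from P(1) interpret prob_space P by (simp add: labelled_distribution_def)
  have sets: "sets P = sets borel" and ae: "AE z in P. snd z \<in> {- 1, 1}"
    using P(1) by (auto simp: labelled_distribution_def case_prod_unfold)
  define h where "h w z = max (1 - snd z * (w \<bullet> fst z)) 0" for w :: "real ^ 'd" and z :: "_ \<times> real"
  have h: "integrable P (h w)" "expected_hinge P w = integral\<^sup>L P (h w)" for w
    using integrable_hinge[OF P, of w]
    by (simp_all add: h_def[abs_def] case_prod_unfold expected_hinge_def)
  define A :: "((real ^ 'd) \<times> real) set" where "A = {z. \<bar>u \<bullet> fst z\<bar> \<le> 1}"
  have "closed A" unfolding A_def by (intro closed_Collect_le continuous_intros)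
  then have A: "A \<in> sets P" by (simp add: sets)
  have space: "space P = UNIV" using sets_eq_imp_space_eq[OF sets] by simp
  have ind: "integrable P (\<lambda>z. 2 * indicator A z :: real)"
    using A by (simp add: integrable_indicator_iff emeasure_eq_measure)
  have "integral\<^sup>L P (h u) \<le> integral\<^sup>L P (\<lambda>z. h (s *\<^sub>R u) z + 2 * indicator A z)"
  proof (rule integral_mono_AE)
    show "AE z in P. h u z \<le> h (s *\<^sub>R u) z + 2 * indicator A z"
      using ae
    proof eventually_elim
      case (elim z)
      \<comment> \<open>The label drops out, so the band becomes an event about \<open>x\<close>
        alone.\<close>
      then have "\<bar>snd z * (u \<bullet> fst z)\<bar> = \<bar>u \<bullet> fst z\<bar>" by auto
      then show ?case
        using hinge_le_hinge_scaled[OF \<open>1 \<le> s\<close>, of "snd z * (u \<bullet> fst z)"]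
        by (simp add: h_def A_def indicator_def mult.left_commute)
    qed
  qed (use h(1) ind in auto)
  also have "\<dots> = integral\<^sup>L P (h (s *\<^sub>R u)) + 2 * measure P A"
    using h(1) ind A space by simp
  also have "A = {(x, y) \<in> space P. \<bar>u \<bullet> x\<bar> \<le> 1}"
    by (auto simp: A_def space)
  finally show ?thesis by (simp add: h(2))
qed

theorem lemma4p10:
  fixes P :: "((real ^ 'd) \<times> real) measure"
    and \<sigma> B lam :: real
    and w :: "real ^ 'd"
  assumes "labelled_distribution P"
    and "\<sigma> > 0" and "B > 0" and "lam > 0"
    and "has_second_moment P"
    and "second_moment P \<preceq>\<^sub>L (\<sigma>\<^sup>2) *\<^sub>R mat 1"
    and "\<And>v :: real ^ 'd. norm v = 1 \<Longrightarrow>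
           measure P {(x, y) \<in> space P. \<bar>v \<bullet> x\<bar> \<le> lam * \<sigma>} \<le> B * lam"
  shows "expected_hinge P (ball_projection (1 / (lam * \<sigma>)) w)
           \<le> expected_hinge P w + 2 * B * lam"
proof -
  define r where "r = 1 / (lam * \<sigma>)"
  have r: "r > 0" "lam * \<sigma> = 1 / r" using assms(2,4) by (simp_all add: r_def)
  show ?thesis
  proof (cases "norm w \<le> r")
    case True
    then have "ball_projection r w = w"
      by (simp add: ball_projection_def closest_point_self)
    then show ?thesis using assms(3,4) by (simp add: r_def)
  next
    case False
    then have w: "r < norm w" "w \<noteq> 0" using r(1) by auto
    define v where "v = w /\<^sub>R norm w"
    \<comment> \<open>The factor that undoes the projection; it exceeds 1 because \<open>w\<close>
      lies outside the ball.\<close>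
    define s where "s = norm w / r"
    have v: "norm v = 1" using w by (simp add: v_def)
    have s: "1 \<le> s" "w = s *\<^sub>R (r *\<^sub>R v)" using w r(1) by (simp_all add: s_def v_def)
    have proj: "ball_projection r w = r *\<^sub>R v"
      using w r(1) by (simp add: ball_projection_eq v_def min_absorb2 flip: divide_inverse)
    \<comment> \<open>The choice of radius matters here: dividing the threshold 1 by
      \<open>r\<close> gives exactly the width in the hypothesis on unit vectors.\<close>
    have "\<bar>(r *\<^sub>R v) \<bullet> x\<bar> \<le> 1 \<longleftrightarrow> \<bar>v \<bullet> x\<bar> \<le> lam * \<sigma>" for x
      unfolding r(2) using r(1) by (simp add: abs_mult field_simps)
    then have "measure P {(x, y) \<in> space P. \<bar>(r *\<^sub>R v) \<bullet> x\<bar> \<le> 1} \<le> B * lam"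
      using assms(7)[OF v] by simp
    then show ?thesis
      using expected_hinge_le_scaled[OF assms(1,5) s(1), of "r *\<^sub>R v", folded s(2)]
      unfolding r_def[symmetric] proj by linarith
  qed
qed

end
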